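(* Let $\sigma>0$, $\gamma>0$, $K\ge 1$ an integer, $\Delta=2\gamma/K$, $P_0>0$, $\varepsilon\in(0,1)$, and let $\bar W=W+W_q$ with $W\sim\mathcal N(0,\sigma^2)$ and $W_q\sim\mathcal U(-\Delta/2,\Delta/2)$ independent. Let $f_{\bar W}$ and $F_{\bar W}$ be the density and the cumulative distribution function of $\bar W$, and let $A>0$ satisfy $1-[F_{\bar W}(\gamma-A)-F_{\bar W}(-\gamma-A)]=\varepsilon$. Let $C(A,P_0)$ be the capacity of the additive-noise channel $Y=X+\bar W$ under the constraints $|X|\le A$ and $\mathbb E[X^2]\le P_0$ (as defined in the context). Then $$C(A,P_0)\le \frac12\log\!\left(2\pi e\left(\min\{A^2,P_0\}+\sigma^2+\frac{\Delta^2}{12}\right)\right)-h(\bar W),$$ where $h(\bar W)=-\int_{-\infty}^{\infty} f_{\bar W}(w)\log f_{\bar W}(w)\,dw$.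
   Context: Channel model: the real-valued input $X$ is independent of the noise $\bar W$, and the output is $Y=X+\bar W$, where $\bar W=W+W_q$ is the sum of independent Gaussian noise $W\sim\mathcal N(0,\sigma^2)$ and uniform noise $W_q\sim\mathcal U(-\Delta/2,\Delta/2)$. (This represents an additive Gaussian channel followed by a $K$-level subtractive dithered uniform quantizer with range $[-\gamma,\gamma]$ and step size $\Delta=2\gamma/K$; the peak amplitude $A$ is the one for which the overload probability $\Pr(|x+W+D|>\gamma)$ at $x=A$, with dither $D\sim\mathcal U(-\Delta/2,\Delta/2)$ independent of $W$, equals the tolerance $\varepsilon$.) Capacity: $C(A,P_0)=\sup_{P_X\in\mathcal F} I(X;Y)$, where $\mathcal F=\{P_X:\ \mathbb E[X^2]\le P_0,\ |X|\le A \text{ almost surely}\}$ is a set of probability distributions on $\mathbb R$, and $I(X;Y)$ is the mutual information. For this channel $I(X;Y)=h(Y)-h(\bar W)$, where $h(\cdot)$ denotes differential entropy. Logarithms are natural, and mutual information and entropy are measured in nats. *)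

theory Defs
  imports "HOL-Probability.Probability"
begin

text \<open>
  Mutual information in nats. The library's real-valued \<open>mutual_information\<close> is a Bochner integral and
  so is meaningful only if the joint law is absolutely continuous with respect to the product of the
  marginals and the information density is integrable. The negative part of that density is always
  integrable, so in every other case the mutual information is infinite.
\<close>

definition (in prob_space) ext_mutual_information ::
  "'b measure \<Rightarrow> 'c measure \<Rightarrow> ('a \<Rightarrow> 'b) \<Rightarrow> ('a \<Rightarrow> 'c) \<Rightarrow> ereal" where
  "ext_mutual_information S T X Y =
    (let P = distr M S X \<Otimes>\<^sub>M distr M T Y;
         Q = distr M (S \<Otimes>\<^sub>M T) (\<lambda>\<omega>. (X \<omega>, Y \<omega>))
     in if absolutely_continuous P Q \<and> integrable Q (entropy_density (exp 1) P Q)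
        then ereal (mutual_information (exp 1) S T X Y) else \<infinity>)"

text \<open>
  \<open>I(X; X + Z)\<close> for an input of law \<open>P\<close> and an independent noise \<open>Z\<close> of law \<open>N\<close>, realised as the
  coordinates of the product space.
\<close>

definition additive_channel_information :: "real measure \<Rightarrow> real measure \<Rightarrow> ereal" where
  "additive_channel_information N P =
    prob_space.ext_mutual_information (P \<Otimes>\<^sub>M N) borel borel (\<lambda>(x, z). x) (\<lambda>(x, z). x + z)"

text \<open>The amplitude constraint makes the second moment integrable.\<close>

definition admissible_inputs :: "real \<Rightarrow> real \<Rightarrow> real measure set" where
  "admissible_inputs A P0 =
    {P. prob_space P \<and> sets P = sets borel \<and> (\<integral>x. x\<^sup>2 \<partial>P) \<le> P0 \<and> (AE x in P. \<bar>x\<bar> \<le> A)}"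

definition additive_channel_capacity :: "real measure \<Rightarrow> real \<Rightarrow> real \<Rightarrow> ereal" where
  "additive_channel_capacity N A P0 =
    (SUP P \<in> admissible_inputs A P0. additive_channel_information N P)"

definition differential_entropy :: "(real \<Rightarrow> real) \<Rightarrow> real" where
  "differential_entropy f = - (\<integral>w. f w * ln (f w) \<partial>lborel)"

end

theory Submission
  imports Defs
begin

text \<open>
  The noise density \<open>f\<close> satisfies \<open>\<bar>ln f(w)\<bar> \<le> a + b w\<^sup>2\<close>, and this property passes to the density \<open>g\<close> of
  \<open>X + Z\<close> for every bounded independent \<open>X\<close>. Since second moments are finite, both \<open>ln f(Z)\<close> and \<open>ln g(Y)\<close>
  are integrable, so the information density \<open>ln (f(Y - X) / g(Y))\<close> is integrable and
  \<open>I(X; Y) = h(Y) - h(Z)\<close>. Comparing \<open>g\<close> with a Gaussian density bounds \<open>h(Y)\<close> through the second moment,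
  which is \<open>E X\<^sup>2 + E Z\<^sup>2\<close> because \<open>Z\<close> is centred.

  The smoothing step is used twice: once with the uniform law as bounded input and Gaussian noise, which
  yields an everywhere positive version of the density of \<open>Wbar\<close>, and once with the channel input and that
  density. The given density \<open>f\<close> in the theorem agrees with this version only almost everywhere.
\<close>

section \<open>Densities whose logarithm grows at most quadratically\<close>

definition log_quadratic :: "(real \<Rightarrow> real) \<Rightarrow> bool" where
  "log_quadratic f \<longleftrightarrow> f \<in> borel_measurable borel \<and> (\<forall>w. 0 < f w) \<and>
    (\<exists>a b. 0 \<le> b \<and> (\<forall>w. \<bar>ln (f w)\<bar> \<le> a + b * w\<^sup>2))"

lemma log_quadratic_normal_density:
  assumes "\<sigma> > 0"
  shows "log_quadratic (normal_density 0 \<sigma>)"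
proof -
  have "\<bar>ln (normal_density 0 \<sigma> w)\<bar> \<le> \<bar>ln (1 / sqrt (2 * pi * \<sigma>\<^sup>2))\<bar> + (1 / (2 * \<sigma>\<^sup>2)) * w\<^sup>2" for w
  proof -
    have "ln (normal_density 0 \<sigma> w) = ln (1 / sqrt (2 * pi * \<sigma>\<^sup>2)) - (1 / (2 * \<sigma>\<^sup>2)) * w\<^sup>2"
      using assms unfolding normal_density_def by (subst ln_mult) auto
    moreover have "0 \<le> (1 / (2 * \<sigma>\<^sup>2)) * w\<^sup>2" by simp
    ultimately show ?thesis by linarith
  qed
  then show ?thesis
    unfolding log_quadratic_def
    using normal_density_pos[OF assms] by (intro conjI allI exI[of _ "1 / (2 * \<sigma>\<^sup>2)"] exI) auto
qed

lemma integrable_ln_log_quadratic: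
  assumes "log_quadratic f" and [measurable]: "X \<in> borel_measurable M"
    and "finite_measure M" and int: "integrable M (\<lambda>\<omega>. (X \<omega>)\<^sup>2)"
  shows "integrable M (\<lambda>\<omega>. ln (f (X \<omega>)))"
proof -
  interpret finite_measure M by fact
  obtain a b where b: "\<And>w. \<bar>ln (f w)\<bar> \<le> a + b * w\<^sup>2" and [measurable]: "f \<in> borel_measurable borel"
    using assms(1) unfolding log_quadratic_def by blast
  show ?thesis
    by (rule Bochner_Integration.integrable_bound[of _ "\<lambda>\<omega>. a + b * (X \<omega>)\<^sup>2"])
       (use int in \<open>auto intro!: AE_I2 order_trans[OF b]\<close>)
qed

section \<open>Convolution of a density with a bounded input law\<close>

locale bounded_input = prob_space P for P :: "real measure" and A :: real and f :: "real \<Rightarrow> real" +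
  assumes sets_P [measurable_cong, simp]: "sets P = sets borel"
    and bounded: "AE x in P. \<bar>x\<bar> \<le> A"
    and log_quadratic: "log_quadratic f"
    and prob_noise: "prob_space (density lborel f)"
begin

definition "noise = density lborel f"

definition "received = distr (P \<Otimes>\<^sub>M noise) borel (\<lambda>(x, z). x + z)"

text \<open>The convolution of \<open>f\<close> with the input law: an output density with a
  definite value at every point.\<close>

definition "mixture y = (\<integral>x. f (y - x) \<partial>P)"

lemma f_measurable [measurable]: "f \<in> borel_measurable borel"
  and f_pos: "0 < f w"
  using log_quadratic by (auto simp: log_quadratic_def)

lemma sets_noise [measurable_cong, simp]: "sets noise = sets borel"
  by (simp add: noise_def)

lemma space_P [simp]: "space P = UNIV"
  using sets_eq_imp_space_eq[OF sets_P] by simp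

lemma space_noise [simp]: "space noise = UNIV"
  by (simp add: noise_def)

sublocale noise: prob_space noise
  using prob_noise by (simp add: noise_def)

sublocale joint: pair_prob_space P noise ..

text \<open>For \<open>\<bar>x\<bar> \<le> A\<close> the shift satisfies
  \<open>(y - x)\<^sup>2 \<le> 2 * A\<^sup>2 + 2 * y\<^sup>2\<close>, so the quadratic bound on
  \<open>ln f\<close> survives with constants independent of \<open>x\<close>. This uniformity in
  \<open>x\<close> lets both bounds pass through integration against \<open>P\<close>.\<close>

lemma f_shift_bounds:
  obtains a b where "0 \<le> b" and "\<And>y. AE x in P. exp (- (a + b * y\<^sup>2)) \<le> f (y - x)"
    and "\<And>y. AE x in P. f (y - x) \<le> exp (a + b * y\<^sup>2)"
proof -
  obtain a b where b: "0 \<le> b" "\<And>w. \<bar>ln (f w)\<bar> \<le> a + b * w\<^sup>2"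
    using log_quadratic unfolding log_quadratic_def by blast
  have main: "\<bar>ln (f (y - x))\<bar> \<le> (a + 2 * b * A\<^sup>2) + 2 * b * y\<^sup>2" if "\<bar>x\<bar> \<le> A" for x y
  proof -
    have "x\<^sup>2 \<le> A\<^sup>2" using that by (simp add: abs_le_square_iff[symmetric])
    moreover have "(y - x)\<^sup>2 \<le> 2 * x\<^sup>2 + 2 * y\<^sup>2"
      using zero_le_power2[of "x + y"] by (simp add: power2_eq_square algebra_simps)
    ultimately have "(y - x)\<^sup>2 \<le> 2 * A\<^sup>2 + 2 * y\<^sup>2" by linarith
    then have "b * (y - x)\<^sup>2 \<le> b * (2 * A\<^sup>2 + 2 * y\<^sup>2)" using b(1) by (rule mult_left_mono)
    then show ?thesis using b(2)[of "y - x"] by (simp add: algebra_simps)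
  qed
  have eq: "f w = exp (ln (f w))" for w using f_pos[of w] by simp
  have "exp (- ((a + 2 * b * A\<^sup>2) + 2 * b * y\<^sup>2)) \<le> f (y - x)"
       "f (y - x) \<le> exp ((a + 2 * b * A\<^sup>2) + 2 * b * y\<^sup>2)" if "\<bar>x\<bar> \<le> A" for x y
    by (subst eq, use main[OF that, of y] in \<open>simp del: exp_ln\<close>)+
  then show ?thesis
    using b(1) bounded by (intro that[of "2 * b" "a + 2 * b * A\<^sup>2"]) auto
qed

lemma integrable_f_shift: "integrable P (\<lambda>x. f (y - x))"
proof (rule f_shift_bounds)
  fix a b
  assume "\<And>y. AE x in P. f (y - x) \<le> exp (a + b * y\<^sup>2)"
  then show ?thesis
    by (intro integrable_const_bound[of _ "exp (a + b * y\<^sup>2)"]) (auto simp: f_pos less_imp_le)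
qed

lemma mixture_measurable [measurable]: "mixture \<in> borel_measurable borel"
  unfolding mixture_def by measurable

text \<open>A probability average of values lying between \<open>exp (- (a + b * y\<^sup>2))\<close>
  and \<open>exp (a + b * y\<^sup>2)\<close> lies between the same bounds; the lower one also gives
  positivity.\<close>

lemma log_quadratic_mixture: "log_quadratic mixture"
proof (rule f_shift_bounds)
  fix a b :: real
  assume b: "0 \<le> b" and lower: "\<And>y. AE x in P. exp (- (a + b * y\<^sup>2)) \<le> f (y - x)"
    and upper: "\<And>y. AE x in P. f (y - x) \<le> exp (a + b * y\<^sup>2)"
  have l: "exp (- (a + b * y\<^sup>2)) \<le> mixture y" for y
    unfolding mixture_def by (rule integral_ge_const[OF integrable_f_shift lower])
  have u: "mixture y \<le> exp (a + b * y\<^sup>2)" for y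
    unfolding mixture_def by (rule integral_le_const[OF integrable_f_shift upper])
  have pos: "0 < mixture y" for y by (rule less_le_trans[OF _ l]) simp
  have "\<bar>ln (mixture y)\<bar> \<le> a + b * y\<^sup>2" for y
    using l[of y] u[of y] pos[of y]
    by (metis abs_le_iff exp_le_cancel_iff exp_ln minus_le_iff)
  then show ?thesis
    unfolding log_quadratic_def using b pos by (intro conjI allI exI[of _ a] exI[of _ b]) auto
qed

lemma mixture_pos: "0 < mixture y"
  using log_quadratic_mixture by (simp add: log_quadratic_def)

lemma ennreal_mixture: "ennreal (mixture y) = (\<integral>\<^sup>+x. f (y - x) \<partial>P)"
  unfolding mixture_def
  by (rule nn_integral_eq_integral[symmetric]) (auto simp: integrable_f_shift f_pos less_imp_le)

text \<open>For fixed \<open>x\<close>, Lebesgue measure is invariant under the translation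
  \<open>y = x + z\<close>, so \<open>f (y - x)\<close> acts as the conditional density of the
  output given the input. Different choices of \<open>h\<close> yield the law of the output and the
  joint law of input and output.\<close>

lemma nn_integral_joint:
  fixes h :: "real \<times> real \<Rightarrow> ennreal"
  assumes [measurable]: "h \<in> borel_measurable (borel \<Otimes>\<^sub>M borel)"
  shows "(\<integral>\<^sup>+(x, z). h (x, x + z) \<partial>(P \<Otimes>\<^sub>M noise)) = (\<integral>\<^sup>+x. \<integral>\<^sup>+y. f (y - x) * h (x, y) \<partial>lborel \<partial>P)"
proof -
  have "(\<integral>\<^sup>+(x, z). h (x, x + z) \<partial>(P \<Otimes>\<^sub>M noise)) = (\<integral>\<^sup>+x. \<integral>\<^sup>+z. h (x, x + z) \<partial>noise \<partial>P)"
    by (subst noise.nn_integral_fst[symmetric]) simp_all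
  also have "\<dots> = (\<integral>\<^sup>+x. \<integral>\<^sup>+z. f z * h (x, x + z) \<partial>lborel \<partial>P)"
    unfolding noise_def by (subst nn_integral_density) auto
  also have "\<dots> = (\<integral>\<^sup>+x. \<integral>\<^sup>+y. f (y - x) * h (x, y) \<partial>lborel \<partial>P)"
  proof (rule nn_integral_cong)
    fix x :: real
    show "(\<integral>\<^sup>+z. f z * h (x, x + z) \<partial>lborel) = (\<integral>\<^sup>+y. f (y - x) * h (x, y) \<partial>lborel)"
      by (subst nn_integral_real_affine[where c = 1 and t = x and f = "\<lambda>y. ennreal (f (y - x)) * h (x, y)"])
         auto
  qed
  finally show ?thesis .
qed

text \<open>Test functions of \<open>y\<close> alone, followed by Tonelli: integrating the
  conditional density over the input first leaves \<open>mixture\<close>.\<close>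

lemma received_eq_density: "received = density lborel mixture"
proof (rule measure_eqI)
  fix B assume "B \<in> sets received"
  then have B [measurable]: "B \<in> sets borel" by (simp add: received_def)
  interpret PL: pair_sigma_finite P lborel ..
  have "emeasure received B = (\<integral>\<^sup>+y. indicator B y \<partial>received)"
    by (simp add: received_def)
  also have "\<dots> = (\<integral>\<^sup>+(x, z). indicator B (x + z) \<partial>(P \<Otimes>\<^sub>M noise))"
    unfolding received_def by (subst nn_integral_distr) (auto simp: case_prod_unfold)
  also have "\<dots> = (\<integral>\<^sup>+x. \<integral>\<^sup>+y. ennreal (f (y - x)) * indicator B y \<partial>lborel \<partial>P)"
    using nn_integral_joint[of "\<lambda>(x, y). indicator B y"] by simp
  also have "\<dots> = (\<integral>\<^sup>+y. \<integral>\<^sup>+x. ennreal (f (y - x)) * indicator B y \<partial>P \<partial>lborel)"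
    by (rule PL.Fubini'[symmetric]) simp
  also have "\<dots> = (\<integral>\<^sup>+y. ennreal (mixture y) * indicator B y \<partial>lborel)"
    by (subst nn_integral_multc) (auto simp: ennreal_mixture)
  also have "\<dots> = emeasure (density lborel mixture) B"
    by (simp add: emeasure_density)
  finally show "emeasure received B = emeasure (density lborel mixture) B" .
qed (simp add: received_def)

lemma sets_received [measurable_cong, simp]: "sets received = sets borel"
  by (simp add: received_def)

sublocale received: prob_space received
  unfolding received_def by (rule joint.prob_space_distr) simp

text \<open>The density is the conditional output density divided by the marginal one, so its
  logarithm is the information density of the channel.\<close>

lemma joint_eq_density:
  "distr (P \<Otimes>\<^sub>M noise) (borel \<Otimes>\<^sub>M borel) (\<lambda>(x, z). (x, x + z))
    = density (P \<Otimes>\<^sub>M received) (\<lambda>(x, y). f (y - x) / mixture y)" (is "?Q = ?D")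
proof (rule measure_eqI)
  show "sets ?Q = sets ?D"
    by (simp cong: sets_pair_measure_cong)
  fix B assume "B \<in> sets ?Q"
  then have B [measurable]: "B \<in> sets (borel \<Otimes>\<^sub>M borel)" by simp
  have B' [measurable]: "B \<in> sets (P \<Otimes>\<^sub>M received)"
    using B by (simp cong: sets_pair_measure_cong)
  have "emeasure ?Q B = (\<integral>\<^sup>+p. indicator B p \<partial>?Q)"
    by simp
  also have "\<dots> = (\<integral>\<^sup>+(x, z). indicator B (x, x + z) \<partial>(P \<Otimes>\<^sub>M noise))"
    by (subst nn_integral_distr) (auto simp: case_prod_unfold)
  also have "\<dots> = (\<integral>\<^sup>+x. \<integral>\<^sup>+y. ennreal (f (y - x)) * indicator B (x, y) \<partial>lborel \<partial>P)"
    by (rule nn_integral_joint) simp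
  \<comment> \<open>Multiplying and dividing by \<open>mixture y\<close> is legitimate at every
    \<open>y\<close>, since \<open>mixture\<close> is positive everywhere.\<close>
  also have "\<dots> = (\<integral>\<^sup>+x. \<integral>\<^sup>+y. ennreal (mixture y) * (ennreal (f (y - x) / mixture y) * indicator B (x, y)) \<partial>lborel \<partial>P)"
    using mixture_pos
    by (intro nn_integral_cong)
       (simp add: mult.assoc[symmetric] ennreal_mult[symmetric] less_imp_le f_pos less_imp_neq[symmetric])
  also have "\<dots> = (\<integral>\<^sup>+x. \<integral>\<^sup>+y. ennreal (f (y - x) / mixture y) * indicator B (x, y) \<partial>received \<partial>P)"
    unfolding received_eq_density by (subst nn_integral_density) auto
  also have "\<dots> = (\<integral>\<^sup>+(x, y). ennreal (f (y - x) / mixture y) * indicator B (x, y) \<partial>(P \<Otimes>\<^sub>M received))"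
    by (subst received.nn_integral_fst[symmetric]) (auto simp: case_prod_unfold)
  also have "\<dots> = emeasure ?D B"
    by (subst emeasure_density) (auto simp: case_prod_unfold)
  finally show "emeasure ?Q B = emeasure ?D B" .
qed

lemma integrable_input: "integrable P (\<lambda>x. x)" and integrable_input_sq: "integrable P (\<lambda>x. x\<^sup>2)"
proof -
  show "integrable P (\<lambda>x. x)" using bounded by (intro integrable_const_bound[of _ A]) auto
  show "integrable P (\<lambda>x. x\<^sup>2)"
    using bounded by (intro integrable_const_bound[of _ "A\<^sup>2"]) (auto simp: abs_le_square_iff[symmetric])
qed

lemma distr_fst: "distr (P \<Otimes>\<^sub>M noise) P fst = P"
  by (rule noise.distr_pair_fst)

lemma distr_snd: "distr (P \<Otimes>\<^sub>M noise) noise snd = noise"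
proof -
  have "emeasure (P \<Otimes>\<^sub>M noise) (snd -` B \<inter> space (P \<Otimes>\<^sub>M noise)) = emeasure noise B"
    if "B \<in> sets noise" for B
  proof -
    have "snd -` B \<inter> space (P \<Otimes>\<^sub>M noise) = space P \<times> B"
      using sets.sets_into_space[OF that] by (auto simp: space_pair_measure)
    then show ?thesis
      using that by (simp only:, subst noise.emeasure_pair_measure_Times) (auto simp: emeasure_space_1[simplified])
  qed
  then show ?thesis by (intro measure_eqI) (auto simp: emeasure_distr)
qed

lemma
  fixes u :: "real \<Rightarrow> real"
  assumes u: "integrable P u"
  shows integrable_joint_fst: "integrable (P \<Otimes>\<^sub>M noise) (\<lambda>p. u (fst p))"
    and integral_joint_fst: "(\<integral>p. u (fst p) \<partial>(P \<Otimes>\<^sub>M noise)) = (\<integral>x. u x \<partial>P)"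
proof -
  have [measurable]: "u \<in> borel_measurable P" using u by simp
  show "integrable (P \<Otimes>\<^sub>M noise) (\<lambda>p. u (fst p))"
    using u by (subst integrable_distr_eq[symmetric, of fst _ P u]) (auto simp: distr_fst)
  show "(\<integral>p. u (fst p) \<partial>(P \<Otimes>\<^sub>M noise)) = (\<integral>x. u x \<partial>P)"
    using u by (subst integral_distr[symmetric, of fst _ P u]) (auto simp: distr_fst)
qed

lemma
  fixes u :: "real \<Rightarrow> real"
  assumes u: "integrable noise u"
  shows integrable_joint_snd: "integrable (P \<Otimes>\<^sub>M noise) (\<lambda>p. u (snd p))"
    and integral_joint_snd: "(\<integral>p. u (snd p) \<partial>(P \<Otimes>\<^sub>M noise)) = (\<integral>x. u x \<partial>noise)"
proof -
  have [measurable]: "u \<in> borel_measurable noise" using u by simp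
  show "integrable (P \<Otimes>\<^sub>M noise) (\<lambda>p. u (snd p))"
    using u by (subst integrable_distr_eq[symmetric, of snd _ noise u]) (auto simp: distr_snd)
  show "(\<integral>p. u (snd p) \<partial>(P \<Otimes>\<^sub>M noise)) = (\<integral>x. u x \<partial>noise)"
    using u by (subst integral_distr[symmetric, of snd _ noise u]) (auto simp: distr_snd)
qed

end

section \<open>Output moments and mutual information for centred noise\<close>

locale centered_channel = bounded_input +
  assumes noise_sq: "integrable noise (\<lambda>z. z\<^sup>2)"
    and noise_mean: "(\<integral>z. z \<partial>noise) = 0"
begin

lemma integrable_noise: "integrable noise (\<lambda>z. z)"
  using noise_sq by (rule noise.square_integrable_imp_integrable[rotated]) simp

text \<open>The second moments add because the cross term is E X times E Z, with E Z = 0. The mean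
  and the square integrability are what \<open>centered_channel\<close> demands of a noise, so the
  output of one channel can serve as the noise of another.\<close>

lemma
  shows received_mean: "(\<integral>y. y \<partial>received) = (\<integral>x. x \<partial>P)"
    and integrable_received_sq: "integrable received (\<lambda>y. y\<^sup>2)"
    and received_sq: "(\<integral>y. y\<^sup>2 \<partial>received) = (\<integral>x. x\<^sup>2 \<partial>P) + (\<integral>z. z\<^sup>2 \<partial>noise)"
proof -
  let ?J = "P \<Otimes>\<^sub>M noise"
  note ints = integrable_joint_fst[OF integrable_input] integrable_joint_snd[OF integrable_noise]
    integrable_joint_fst[OF integrable_input_sq] integrable_joint_snd[OF noise_sq]
  note vals = integral_joint_fst[OF integrable_input] integral_joint_snd[OF integrable_noise]
    integral_joint_fst[OF integrable_input_sq] integral_joint_snd[OF noise_sq]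
  have ae: "AE p in ?J. \<bar>fst p\<bar> \<le> A"
    using bounded by (subst (asm) distr_fst[symmetric], subst (asm) AE_distr_iff) auto
  \<comment> \<open>Almost surely the product of input and noise is dominated by \<open>A\<close>
    times the absolute value of the noise.\<close>
  have "integrable ?J (\<lambda>p. A * snd p)" using ints(2) by simp
  then have cross: "integrable ?J (\<lambda>p. fst p * snd p)"
    by (rule Bochner_Integration.integrable_bound)
       (use ae in \<open>auto simp: abs_mult intro!: mult_right_mono\<close>)
  have "(\<integral>p. fst p * snd p \<partial>?J) = (\<integral>x. (\<integral>z. x * z \<partial>noise) \<partial>P)"
    using joint.integral_fst[of "\<lambda>x z. x * z"] cross by (simp add: case_prod_unfold)
  then have cross0: "(\<integral>p. fst p * snd p \<partial>?J) = 0" by (simp add: noise_mean)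
  have sq: "(case p of (x, z) \<Rightarrow> x + z)\<^sup>2 = (fst p)\<^sup>2 + (snd p)\<^sup>2 + 2 * (fst p * snd p)" for p :: "real \<times> real"
    by (cases p) (simp add: power2_eq_square algebra_simps)
  show "(\<integral>y. y \<partial>received) = (\<integral>x. x \<partial>P)"
    unfolding received_def
    by (subst integral_distr; use ints vals noise_mean in \<open>simp add: case_prod_unfold\<close>)
  show "integrable received (\<lambda>y. y\<^sup>2)"
    unfolding received_def
    by (subst integrable_distr_eq; use ints cross in \<open>simp add: sq\<close>)
  show "(\<integral>y. y\<^sup>2 \<partial>received) = (\<integral>x. x\<^sup>2 \<partial>P) + (\<integral>z. z\<^sup>2 \<partial>noise)"
    unfolding received_def
    by (subst integral_distr; use ints cross cross0 vals in \<open>simp add: sq\<close>)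
qed

lemma differential_entropy_eq: "differential_entropy f = - (\<integral>z. ln (f z) \<partial>noise)"
  unfolding differential_entropy_def noise_def
  by (subst integral_density) (auto simp: f_pos less_imp_le)

text \<open>The information density splits into \<open>ln (f (y - x))\<close>, which depends on the
  noise alone, and \<open>ln (mixture y)\<close>, which depends on the output alone. Each is
  integrable, so the finite branch of \<open>ext_mutual_information\<close> applies and the
  expectation is h(Y) - h(Z).\<close>

lemma channel_information:
  "additive_channel_information noise P
    = ereal (- (\<integral>y. ln (mixture y) \<partial>received) - differential_entropy f)"
proof -
  let ?J = "P \<Otimes>\<^sub>M noise"
  let ?X = "\<lambda>(x, z). x :: real" and ?Y = "\<lambda>(x, z). x + z :: real"
  let ?P = "distr ?J borel ?X \<Otimes>\<^sub>M distr ?J borel ?Y"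
  let ?Q = "distr ?J (borel \<Otimes>\<^sub>M borel) (\<lambda>p. (?X p, ?Y p))"
  let ?r = "\<lambda>(x, y). f (y - x) / mixture y"
  have "distr ?J borel ?X = distr ?J P fst"
    by (rule distr_cong) (auto simp: case_prod_unfold)
  then have P: "?P = P \<Otimes>\<^sub>M received"
    by (simp add: distr_fst received_def)
  have Q: "?Q = density ?P ?r"
    unfolding P joint_eq_density[symmetric] by (intro distr_cong) auto
  have r [measurable]: "?r \<in> borel_measurable ?P" unfolding P by measurable
  interpret PO: pair_prob_space P received ..
  have ac: "absolutely_continuous ?P ?Q"
    unfolding Q by (rule absolutely_continuousI_density) simp
  \<comment> \<open>\<open>entropy_density\<close> is built on a chosen Radon-Nikodym derivative,
    which uniqueness identifies with the explicit ratio only almost everywhere.\<close>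
  have "AE p in ?P. ennreal (?r p) = RN_deriv ?P ?Q p"
    unfolding P using Q[unfolded P] r[unfolded P] by (intro PO.RN_deriv_unique) auto
  then have "AE p in ?P. entropy_density (exp 1) ?P ?Q p = ln (?r p)"
  proof eventually_elim
    case (elim p)
    have "0 \<le> ?r p" by (simp add: case_prod_unfold f_pos mixture_pos less_imp_le)
    then have "enn2real (RN_deriv ?P ?Q p) = ?r p"
      unfolding elim[symmetric] by (rule enn2real_ennreal)
    then show ?case by (simp only: entropy_density_def comp_apply log_def ln_exp div_by_1)
  qed
  \<comment> \<open>Null sets of the product law are null for the joint law by absolute continuity,
    and the expectation is taken under the joint law.\<close>
  then have "AE p in ?Q. entropy_density (exp 1) ?P ?Q p = ln (?r p)"
    by (rule absolutely_continuous_AE[OF _ ac, rotated]) (simp cong: sets_pair_measure_cong)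
  then have ed: "AE p in ?Q. entropy_density (exp 1) ?P ?Q p
      = ln (f (snd p - fst p)) - ln (mixture (snd p))"
    by eventually_elim (simp add: case_prod_unfold ln_div f_pos mixture_pos less_imp_neq[symmetric])
  have sets: "sets ?P = sets (borel \<Otimes>\<^sub>M borel)" by (simp cong: sets_pair_measure_cong)
  have [measurable]: "entropy_density (exp 1) ?P ?Q \<in> borel_measurable (borel \<Otimes>\<^sub>M borel)"
    using measurable_entropy_density[of "exp 1" ?P ?Q]
    by (simp only: measurable_cong_sets[OF sets refl])
  have 1: "integrable noise (\<lambda>z. ln (f z))"
    by (rule integrable_ln_log_quadratic[OF log_quadratic]) (auto simp: noise_sq noise.finite_measure_axioms)
  have 2: "integrable received (\<lambda>y. ln (mixture y))"
    by (rule integrable_ln_log_quadratic[OF log_quadratic_mixture])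
       (auto simp: integrable_received_sq received.finite_measure_axioms)
  have 3: "integrable ?J (\<lambda>p. ln (mixture (?Y p)))"
    using 2 unfolding received_def by (subst (asm) integrable_distr_eq) auto
  have 4: "(\<integral>p. ln (mixture (?Y p)) \<partial>?J) = (\<integral>y. ln (mixture y) \<partial>received)"
    unfolding received_def by (subst integral_distr) auto
  let ?d = "\<lambda>p. ln (f (snd p - fst p)) - ln (mixture (snd p))"
  \<comment> \<open>Pulled back along \<open>(x, z)\<close> to \<open>(x, x + z)\<close>, the first
    logarithm becomes \<open>ln (f z)\<close>.\<close>
  have "integrable ?Q ?d"
    by (subst integrable_distr_eq; use 3 integrable_joint_snd[OF 1] in \<open>simp add: case_prod_unfold\<close>)
  moreover have "integrable ?Q ?d \<longleftrightarrow> integrable ?Q (entropy_density (exp 1) ?P ?Q)"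
    by (rule integrable_cong_AE) (use ed in auto)
  ultimately have int: "integrable ?Q (entropy_density (exp 1) ?P ?Q)" by simp
  have "integral\<^sup>L ?Q (entropy_density (exp 1) ?P ?Q) = integral\<^sup>L ?Q ?d"
    by (rule integral_cong_AE) (use ed in auto)
  also have "\<dots> = (\<integral>z. ln (f z) \<partial>noise) - (\<integral>y. ln (mixture y) \<partial>received)"
    by (subst integral_distr; use 3 4 integrable_joint_snd[OF 1] integral_joint_snd[OF 1] in \<open>simp add: case_prod_unfold\<close>)
  finally have val: "integral\<^sup>L ?Q (entropy_density (exp 1) ?P ?Q)
    = - (\<integral>y. ln (mixture y) \<partial>received) - differential_entropy f"
    by (simp add: differential_entropy_eq)
  show ?thesis
    unfolding additive_channel_information_def joint.ext_mutual_information_def Let_def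
    using ac int val by (simp add: joint.mutual_information_def KL_divergence_def)
qed

lemma channel_information_le:
  assumes B: "0 < B" and le: "(\<integral>x. x\<^sup>2 \<partial>P) + (\<integral>z. z\<^sup>2 \<partial>noise) \<le> B"
  shows "additive_channel_information noise P
    \<le> ereal (1 / 2 * ln (2 * pi * exp 1 * B) - differential_entropy f)"
proof -
  \<comment> \<open>Gibbs' inequality against the centred Gaussian of variance \<open>B\<close>\<close>
  define q where "q = normal_density 0 (sqrt B)"
  have sB: "0 < sqrt B" using B by simp
  have q_pos: "0 < q y" for y unfolding q_def by (rule normal_density_pos[OF sB])
  have [measurable]: "q \<in> borel_measurable borel" unfolding q_def by simp
  have lnq: "ln (q y) = - (1 / 2) * ln (2 * pi * B) - y\<^sup>2 / (2 * B)" for y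
    using B unfolding q_def normal_density_def
    by (subst ln_mult) (auto simp: ln_div ln_sqrt)
  \<comment> \<open>Under the output law the factor \<open>mixture\<close> cancels, leaving the
    total mass of the Gaussian density.\<close>
  have ratio_int: "integrable received (\<lambda>y. q y / mixture y)"
    and ratio: "(\<integral>y. q y / mixture y \<partial>received) = 1"
    unfolding received_eq_density
    using sB
    by (simp_all add: integrable_density integral_density mixture_pos less_imp_le
          less_imp_neq[OF mixture_pos, symmetric] q_def)
  have ln_int: "integrable received (\<lambda>y. ln (mixture y))"
    by (rule integrable_ln_log_quadratic[OF log_quadratic_mixture])
       (auto simp: integrable_received_sq received.finite_measure_axioms)
  \<comment> \<open>Pointwise this is ln t \<le> t - 1 at t = \<open>q y / mixture y\<close>; the
    right-hand side has expectation 0.\<close>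
  have "(\<integral>y. ln (q y) - ln (mixture y) \<partial>received) \<le> (\<integral>y. q y / mixture y - 1 \<partial>received)"
  proof (rule integral_mono)
    show "integrable received (\<lambda>y. ln (q y) - ln (mixture y))"
      using ln_int integrable_received_sq by (simp add: lnq)
    show "ln (q y) - ln (mixture y) \<le> q y / mixture y - 1" for y
      using ln_le_minus_one[of "q y / mixture y"] q_pos[of y] mixture_pos[of y]
      by (simp add: ln_div)
  qed (use ratio_int in simp)
  also have "\<dots> = 0" using ratio ratio_int received.prob_space by simp
  finally have "(\<integral>y. ln (q y) - ln (mixture y) \<partial>received) \<le> 0" .
  then have "- (\<integral>y. ln (mixture y) \<partial>received) \<le> 1 / 2 * ln (2 * pi * B) + (\<integral>y. y\<^sup>2 \<partial>received) / (2 * B)"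
    using ln_int integrable_received_sq received.prob_space by (simp add: lnq)
  also have "(\<integral>y. y\<^sup>2 \<partial>received) / (2 * B) \<le> 1 / 2"
    using le B by (simp add: received_sq field_simps)
  \<comment> \<open>The summand 1/2 is half the logarithm of \<open>exp 1\<close>, which supplies
    the factor e in the bound.\<close>
  also have "1 / 2 * ln (2 * pi * B) + 1 / 2 = 1 / 2 * ln (2 * pi * exp 1 * B)"
    using B by (simp add: ln_mult)
  finally show ?thesis by (simp add: channel_information)
qed

end

section \<open>Moments of the symmetric uniform law\<close>

lemma
  fixes c :: real
  assumes c: "0 < c"
  defines "U \<equiv> uniform_measure lborel {- c .. c}"
  shows prob_space_uniform: "prob_space U"
    and uniform_bounded: "AE x in U. \<bar>x\<bar> \<le> c"
    and uniform_mean: "(\<integral>x. x \<partial>U) = 0"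
    and uniform_sq: "(\<integral>x. x\<^sup>2 \<partial>U) = (2 * c)\<^sup>2 / 12"
proof -
  have em: "emeasure lborel {-c..c} = ennreal (2 * c)" using c by simp
  show p: "prob_space U"
    unfolding U_def using c by (intro prob_space_uniform_measure) auto
  show "AE x in U. \<bar>x\<bar> \<le> c"
    unfolding U_def by (rule AE_uniform_measureI) auto
  interpret prob_space U by fact
  \<comment> \<open>This puts the identity map on \<open>U\<close> into the form required by the
    expectation and variance formulas for uniformly distributed variables.\<close>
  have "U = density lborel (\<lambda>x. ennreal (indicator {-c..c} x / measure lborel {-c..c}))"
    unfolding U_def uniform_measure_def using c
    by (intro density_cong) (auto simp: em divide_ennreal ennreal_indicator[symmetric] simp del: ennreal_indicator)
  then have D: "distributed U lborel (\<lambda>x. x) (\<lambda>x. indicator {-c..c} x / measure lborel {-c..c})"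
    unfolding distributed_def by (auto simp: U_def intro!: trans[OF distr_id2])
  show m: "(\<integral>x. x \<partial>U) = 0" using uniform_distributed_expectation[OF D] by simp
  \<comment> \<open>The mean is zero, so the second moment is the variance: the squared interval
    length \<open>2 * c\<close> over 12.\<close>
  show "(\<integral>x. x\<^sup>2 \<partial>U) = (2 * c)\<^sup>2 / 12"
    using uniform_distributed_variance[OF D] m by simp
qed

section \<open>Capacity bound for Gaussian plus uniform noise\<close>

theorem theorem1:
  fixes M :: "'a measure" and W Wq Wbar :: "'a \<Rightarrow> real" and f F :: "real \<Rightarrow> real"
    and \<sigma> \<gamma> \<Delta> P0 \<epsilon> A :: real and K :: nat
  assumes "\<sigma> > 0" and "\<gamma> > 0" and "K \<ge> 1" and "\<Delta> = 2 * \<gamma> / real K"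
    and "P0 > 0" and "0 < \<epsilon>" and "\<epsilon> < 1"
    and "prob_space M"
    and "prob_space.indep_var M borel W borel Wq"
    and "distr M borel W = density lborel (normal_density 0 \<sigma>)"
    and "distr M borel Wq = uniform_measure lborel {- \<Delta> / 2 .. \<Delta> / 2}"
    and "Wbar = (\<lambda>\<omega>. W \<omega> + Wq \<omega>)"
    and "\<And>w. 0 \<le> f w" and "distributed M lborel Wbar f"
    and "F = cdf (distr M borel Wbar)"
    and "A > 0" and "1 - (F (\<gamma> - A) - F (- \<gamma> - A)) = \<epsilon>"
  shows "additive_channel_capacity (distr M borel Wbar) A P0
    \<le> ereal (1 / 2 * ln (2 * pi * exp 1 * (min (A\<^sup>2) P0 + \<sigma>\<^sup>2 + \<Delta>\<^sup>2 / 12))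
             - differential_entropy f)"
proof -
  interpret M: prob_space M by fact
  have \<Delta>: "0 < \<Delta>" using assms(2-4) by simp
  define U where "U = uniform_measure lborel {- (\<Delta> / 2) .. \<Delta> / 2}"
  have c: "0 < \<Delta> / 2" using \<Delta> by simp
  interpret U: prob_space U unfolding U_def by (rule prob_space_uniform[OF c])
  \<comment> \<open>First smoothing: the quantization noise plays the bounded input and the Gaussian
    plays the noise.\<close>
  interpret noise: bounded_input U "\<Delta> / 2" "normal_density 0 \<sigma>"
  proof (intro bounded_input.intro bounded_input_axioms.intro U.prob_space_axioms)
    show "AE x in U. \<bar>x\<bar> \<le> \<Delta> / 2" unfolding U_def by (rule uniform_bounded[OF c])
  qed (simp_all add: U_def log_quadratic_normal_density prob_space_normal_density assms(1))
  \<comment> \<open>The moments of order 2*0 + 1 and 2*1 of the centred Gaussian.\<close>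
  have gauss: "has_bochner_integral noise.noise (\<lambda>z. z) 0"
      "has_bochner_integral noise.noise (\<lambda>z. z\<^sup>2) (\<sigma>\<^sup>2)"
    unfolding noise.noise_def
    using normal_moment_odd[OF assms(1), of 0 0] normal_moment_even[OF assms(1), of 0 1]
    by (auto intro!: has_bochner_integral_density simp: normal_density_nonneg assms(1))
  interpret noise: centered_channel U "\<Delta> / 2" "normal_density 0 \<sigma>"
    using gauss by unfold_locales (simp_all only: has_bochner_integral_iff)
  define f0 where "f0 = noise.mixture"
  have law: "distr M borel Wbar = density lborel f0"
  proof -
    have [measurable]: "W \<in> borel_measurable M" "Wq \<in> borel_measurable M"
      using assms(9) by (auto dest: M.indep_var_rv1 M.indep_var_rv2)
    have joint: "noise.noise \<Otimes>\<^sub>M U = distr M (borel \<Otimes>\<^sub>M borel) (\<lambda>\<omega>. (W \<omega>, Wq \<omega>))"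
      using assms(9-11) by (simp add: M.indep_var_distribution_eq U_def noise.noise_def)
    \<comment> \<open>Independence gives the product law with \<open>W\<close> first, whereas the
      locale puts the bounded summand first; the swap is harmless because addition commutes.\<close>
    have "noise.received
        = distr (distr (noise.noise \<Otimes>\<^sub>M U) (U \<Otimes>\<^sub>M noise.noise) (\<lambda>(x, y). (y, x))) borel (\<lambda>(x, z). x + z)"
      unfolding noise.received_def by (subst noise.joint.distr_pair_swap) (rule refl)
    also have "\<dots> = distr (noise.noise \<Otimes>\<^sub>M U) borel (\<lambda>(x, z). x + z)"
      by (subst distr_distr) (auto simp: comp_def case_prod_unfold add.commute)
    also have "\<dots> = distr M borel Wbar"
      unfolding joint by (subst distr_distr) (auto simp: assms(12) comp_def)
    finally show ?thesis by (simp add: f0_def noise.received_eq_density)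
  qed
  have "distributed M lborel Wbar f0"
    using assms(14) law distr_cong[of M M lborel borel Wbar Wbar]
    by (simp add: distributed_def f0_def)
  \<comment> \<open>Two densities of \<open>Wbar\<close> agree almost everywhere, so the entropy of
    the given \<open>f\<close> equals that of the positive version \<open>f0\<close>.\<close>
  then have "AE w in lborel. ennreal (f w) = ennreal (f0 w)"
    by (rule M.distributed_unique[OF assms(14)])
  then have ae: "AE w in lborel. f w = f0 w"
    using assms(13) noise.mixture_pos by (auto simp: f0_def less_imp_le)
  have [measurable]: "f \<in> borel_measurable borel"
    using distributed_real_measurable[OF _ assms(14)] assms(13) by simp
  have ent: "differential_entropy f = differential_entropy f0"
    unfolding differential_entropy_def
    by (intro arg_cong[where f = uminus] integral_cong_AE) (use ae in \<open>auto simp: f0_def\<close>)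
  have "additive_channel_information (distr M borel Wbar) P
      \<le> ereal (1 / 2 * ln (2 * pi * exp 1 * (min (A\<^sup>2) P0 + \<sigma>\<^sup>2 + \<Delta>\<^sup>2 / 12)) - differential_entropy f)"
    if P: "P \<in> admissible_inputs A P0" for P
  proof -
    have Pp: "prob_space P" "sets P = sets borel" "(\<integral>x. x\<^sup>2 \<partial>P) \<le> P0" "AE x in P. \<bar>x\<bar> \<le> A"
      using P by (auto simp: admissible_inputs_def)
    interpret P: prob_space P by fact
    have f0: "log_quadratic f0" "density lborel f0 = noise.received"
      unfolding f0_def by (simp_all add: noise.log_quadratic_mixture noise.received_eq_density)
    interpret ch: bounded_input P A f0
      using Pp f0 noise.received.prob_space_axioms
      by (intro bounded_input.intro bounded_input_axioms.intro) simp_all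
    have N: "ch.noise = noise.received" by (simp add: ch.noise_def f0)
    \<comment> \<open>Second smoothing, now with the channel input. The noise is centred because its
      mean equals that of the uniform law, which is zero.\<close>
    interpret ch: centered_channel P A f0
      using noise.integrable_received_sq noise.received_mean uniform_mean[OF c]
      by unfold_locales (simp_all only: N U_def[symmetric])
    \<comment> \<open>The amplitude constraint bounds the input power by \<open>A\<^sup>2\<close>;
      together with the power constraint this produces the minimum.\<close>
    have "(\<integral>x. x\<^sup>2 \<partial>P) \<le> A\<^sup>2"
      using Pp(4) by (intro P.integral_le_const ch.integrable_input_sq) (auto simp: abs_le_square_iff[symmetric])
    then have "(\<integral>x. x\<^sup>2 \<partial>P) + (\<integral>z. z\<^sup>2 \<partial>ch.noise) \<le> min (A\<^sup>2) P0 + \<sigma>\<^sup>2 + \<Delta>\<^sup>2 / 12"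
      using Pp(3) gauss(2) uniform_sq[OF c, folded U_def]
      by (simp add: N noise.received_sq has_bochner_integral_iff)
    moreover have "0 < min (A\<^sup>2) P0 + \<sigma>\<^sup>2 + \<Delta>\<^sup>2 / 12"
      using assms(1,5,16) by (intro add_pos_nonneg) auto
    ultimately show ?thesis
      using ch.channel_information_le by (simp add: ent law ch.noise_def)
  qed
  then show ?thesis
    unfolding additive_channel_capacity_def by (rule SUP_least)
qed

end
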